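(* Let $\le$ be a binary relation on a set $S$ and let $\Lambda,\Pi\subseteq\mathrm{Endo}(S,\le)$. If $\le$ is $(\Lambda,\Pi)$-correct, then $\le$ is $(\Lambda,\Pi)$-strict.
   Context: $\mathrm{Endo}(S,\le)$ is the set of all $f:S\to S$ such that $p\le q$ implies $f(p)\le f(q)$. $p<q$ means $p\le q$ and $q\nleq p$. $\le$ is $(\Lambda,\Pi)$-correct if for all $p,q\in S$ with $p\nleq q$ there is $\sigma\in\Lambda$ such that $\tau(\sigma(p))\nleq\tau(\sigma(q))$ for all $\tau\in\Pi$. $\le$ is $(\Lambda,\Pi)$-strict if for all $p,q\in S$ with $p<q$ there is $\sigma\in\Lambda$ such that $\tau(\sigma(p))<\tau(\sigma(q))$ for all $\tau\in\Pi$. *)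

theory Defs
  imports "HOL-Library.FuncSet"
begin

text \<open>
  A binary relation on a set \<open>S\<close> is given by a predicate \<open>le\<close> of which only the restriction
  to \<open>S\<close> is ever used; no order axioms (not even reflexivity or transitivity) are assumed.
  Likewise, a function \<open>S \<rightarrow> S\<close> is a HOL function mapping \<open>S\<close> into itself, and its values
  outside \<open>S\<close> are irrelevant. The sets written Lambda and Pi in the mathematics are called \<open>L\<close> and
  \<open>P\<close>, because the Greek capital Pi is a binder in the function set theory.
\<close>

definition Endo :: "'a set \<Rightarrow> ('a \<Rightarrow> 'a \<Rightarrow> bool) \<Rightarrow> ('a \<Rightarrow> 'a) set" where
  "Endo S le = {f \<in> S \<rightarrow> S. monotone_on S le le f}"

definition strict_part :: "('a \<Rightarrow> 'a \<Rightarrow> bool) \<Rightarrow> 'a \<Rightarrow> 'a \<Rightarrow> bool" where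
  "strict_part le p q \<longleftrightarrow> le p q \<and> \<not> le q p"

definition correct_rel ::
  "'a set \<Rightarrow> ('a \<Rightarrow> 'a \<Rightarrow> bool) \<Rightarrow> ('a \<Rightarrow> 'a) set \<Rightarrow> ('a \<Rightarrow> 'a) set \<Rightarrow> bool" where
  "correct_rel S le L P \<longleftrightarrow>
     (\<forall>p\<in>S. \<forall>q\<in>S. \<not> le p q \<longrightarrow> (\<exists>\<sigma>\<in>L. \<forall>\<tau>\<in>P. \<not> le (\<tau> (\<sigma> p)) (\<tau> (\<sigma> q))))"

definition strict_rel ::
  "'a set \<Rightarrow> ('a \<Rightarrow> 'a \<Rightarrow> bool) \<Rightarrow> ('a \<Rightarrow> 'a) set \<Rightarrow> ('a \<Rightarrow> 'a) set \<Rightarrow> bool" where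
  "strict_rel S le L P \<longleftrightarrow>
     (\<forall>p\<in>S. \<forall>q\<in>S. strict_part le p q \<longrightarrow>
        (\<exists>\<sigma>\<in>L. \<forall>\<tau>\<in>P. strict_part le (\<tau> (\<sigma> p)) (\<tau> (\<sigma> q))))"

end

theory Submission
  imports Defs
begin

text \<open>A strict inequality has a positive half, \<open>le p q\<close>, and a negative half,
  \<open>\<not> le q p\<close>. Every endomorphism of \<open>S\<close> preserves the positive half,
  hence so does each composite of some \<tau> with some \<sigma>. Correctness carries the negative
  half through one \<sigma> that works for all \<tau> at once, so this same \<sigma> witnesses
  strictness.\<close>

lemma Endo_mapsto: "f \<in> Endo S le \<Longrightarrow> p \<in> S \<Longrightarrow> f p \<in> S"
  by (auto simp: Endo_def)

lemma Endo_mono: "f \<in> Endo S le \<Longrightarrow> p \<in> S \<Longrightarrow> q \<in> S \<Longrightarrow> le p q \<Longrightarrow> le (f p) (f q)"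
  by (auto simp: Endo_def monotone_on_def)

theorem proposition4p10:
  fixes S :: "'a set"
    and le :: "'a \<Rightarrow> 'a \<Rightarrow> bool"
    and L P :: "('a \<Rightarrow> 'a) set"
  assumes "L \<subseteq> Endo S le"
    and "P \<subseteq> Endo S le"
    and "correct_rel S le L P"
  shows "strict_rel S le L P"
  unfolding strict_rel_def
proof (intro ballI impI)
  fix p q assume pq: "p \<in> S" "q \<in> S" "strict_part le p q"
  then have "le p q" "\<not> le q p"
    by (auto simp: strict_part_def)
  \<comment> \<open>Correctness is applied to the reversed pair, \<open>q\<close> before
    \<open>p\<close>, since \<open>le q p\<close> is the relation that fails.\<close>
  with pq assms(3) obtain \<sigma>
    where \<sigma>: "\<sigma> \<in> L" "\<forall>\<tau>\<in>P. \<not> le (\<tau> (\<sigma> q)) (\<tau> (\<sigma> p))"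
    unfolding correct_rel_def by blast
  have "le (\<tau> (\<sigma> p)) (\<tau> (\<sigma> q))" if "\<tau> \<in> P" for \<tau>
  proof -
    have \<tau>\<sigma>: "\<tau> \<in> Endo S le" "\<sigma> \<in> Endo S le"
      using that \<sigma>(1) assms(1,2) by auto
    \<comment> \<open>Monotonicity of \<tau> holds only on \<open>S\<close>, so the images under
      \<sigma> must be known to lie in \<open>S\<close>.\<close>
    have "\<sigma> p \<in> S" "\<sigma> q \<in> S" "le (\<sigma> p) (\<sigma> q)"
      using Endo_mapsto[OF \<tau>\<sigma>(2)] Endo_mono[OF \<tau>\<sigma>(2)] pq(1,2) \<open>le p q\<close> by simp_all
    then show ?thesis
      by (rule Endo_mono[OF \<tau>\<sigma>(1)])
  qed
  with \<sigma> show "\<exists>\<sigma>\<in>L. \<forall>\<tau>\<in>P. strict_part le (\<tau> (\<sigma> p)) (\<tau> (\<sigma> q))"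
    by (auto simp: strict_part_def)
qed

end
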